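(* Let $k\in(\mathcal N_j\cup\{j\})\setminus\{i\}$ and let $$Q_{m,k}^{(n)}(\lambda_k,\beta_k)=-\log\det(\lambda_kK_{\beta_k})-\mathrm{tr}\big((\lambda_kK_{\beta_k})^{-1}\hat{\mathbf M}_k^{(n)}\big),\qquad \lambda_k>0,\ \beta_k\in(0,1).$$ Define $$Q_{\beta,k}^{(n)}(\beta_k)=\log\det(K_{\beta_k})+l\log\Big(\mathrm{tr}\big((K_{\beta_k})^{-1}\hat{\mathbf M}_k^{(n)}\big)\Big).$$ Then the update of the kernel hyperparameters $(\lambda_k,\beta_k)$, i.e. the maximization of $Q_{m,k}^{(n)}(\lambda_k,\beta_k)$, is obtained as $$\hat\beta_k^{(n+1)}=\arg\min_{\beta_k\in(0,1)}Q_{\beta,k}^{(n)}(\beta_k),\qquad \hat\lambda_k^{(n+1)}=\frac1l\,\mathrm{tr}\Big(\big(K_{\hat\beta_k^{(n+1)}}\big)^{-1}\hat{\mathbf M}_k^{(n)}\Big);$$ that is, such a pair $(\hat\lambda_k^{(n+1)},\hat\beta_k^{(n+1)})$ maximizes $Q_{m,k}^{(n)}$.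
   Context: $N,l$ are positive integers. $j$ is the output node, $\mathcal N_j\not\ni j$ is a finite set of input node indices, $i\in\mathcal N_j$, and $\mathcal N_j\setminus\{i\}=\{k_1,\dots,k_p\}$. Measured signals $w_k(t)$, $t=1,\dots,N$, are given; $w_j=[w_j(1)\ \dots\ w_j(N)]^\top$. For $x\in\mathbb R^N$ the $N\times r$ Toeplitz matrix of $x$ has $(s,t)$ entry $x_{s-t+1}$ if $s\ge t$ and $0$ otherwise. $W_k$ is the $N\times l$ Toeplitz matrix of $[0\ w_k(1)\ \dots\ w_k(N-1)]^\top$ for $k\in(\mathcal N_j\cup\{j\})\setminus\{i\}$; $W_\ell^N$ is the $N\times N$ Toeplitz matrix of $[0\ w_\ell(1)\ \dots\ w_\ell(N-1)]^\top$ and $\overleftrightarrow W_\ell$ the $N\times l$ Toeplitz matrix of $[0\ 0\ -w_\ell(1)\ \dots\ -w_\ell(N-2)]^\top$, $\ell\in\{i,j\}$. For $\theta=[\theta_B^\top\ \theta_F^\top]^\top$ (coefficients of numerator and of denominator-minus-one of the target module $G_{ji}$, each of length at most $N$) put $b_{ji}=[\theta_B^\top\ 0^\top]^\top$, $f_{ji}=[\theta_F^\top\ 0^\top]^\top\in\mathbb R^N$, $\mathbf g_{ji}=[b_{ji}^\top\ f_{ji}^\top]^\top$, let $G_b,G_f$ be the $N\times N$ Toeplitz matrices of $b_{ji},f_{ji}$, and $\tilde W=W_j+G_b\overleftrightarrow W_i-G_f\overleftrightarrow W_j$, $\mathbf W_{ji}=[W_i^N\ \ -W_j^N]$, $\mathbf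 W=[\tilde W\ W_{k_1}\ \dots\ W_{k_p}]$. First-order stable spline kernel: $K_\beta\in\mathbb R^{l\times l}$, $[K_\beta]_{x,y}=\beta^{\max(x,y)}$, $x,y=1,\dots,l$. The model is $w_j=\mathbf W\mathbf m+\mathbf W_{ji}\mathbf g_{ji}+\bar e_j$, $\mathbf m=[m_j^\top\ m_{k_1}^\top\dots m_{k_p}^\top]^\top\sim\mathcal N(0,\mathbf K)$, $\mathbf K=\mathrm{diag}\{\lambda_jK_{\beta_j},\lambda_{k_1}K_{\beta_{k_1}},\dots,\lambda_{k_p}K_{\beta_{k_p}}\}$, $\bar e_j\sim\mathcal N(0,\bar\sigma_j^2I_N)$ independent of $\mathbf m$ (with $\mathbf W,\mathbf W_{ji}$ treated as given matrices), and $\eta$ collects $\theta$, all $\lambda$'s, all $\beta$'s and $\bar\sigma_j^2$ (with $\lambda$'s and $\bar\sigma_j^2$ positive and $\beta$'s in $(0,1)$). The posterior of $\mathbf m$ given $w_j$ is Gaussian with covariance $\mathbf P_m=(\mathbf W^\top\mathbf W/\bar\sigma_j^2+\mathbf K^{-1})^{-1}$ and mean $\mathbf P_m\mathbf W^\top(w_j-\mathbf W_{ji}\mathbf g_{ji})/\bar\sigma_j^2$. For a current estimate $\hat\eta^{(n)}$, let $\hat{\mathbf P}_m^{(n)}$ and $\hat{\mathbf m}^{(n)}$ be this covariance and mean evaluated at $\eta=\hat\eta^{(n)}$, let $\hat{\mathbf M}^{(n)}=\hat{\mathbf P}_m^{(n)}+\hat{\mathbf m}^{(n)}\hat{\mathbf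 m}^{(n)\top}$, and let $\hat{\mathbf M}_j^{(n)},\hat{\mathbf M}_{k_1}^{(n)},\dots,\hat{\mathbf M}_{k_p}^{(n)}$ be its consecutive $l\times l$ diagonal blocks. *)

theory Defs
  imports Complex_Main "Jordan_Normal_Form.Gauss_Jordan_Elimination" "Jordan_Normal_Form.Determinant"
begin

text \<open>
  Vectors and matrices are the dimension-carrying ones of \<open>Jordan_Normal_Form.Matrix\<close>; their
  indices start at 0, so entry \<open>(s, t)\<close> below is entry \<open>(s + 1, t + 1)\<close> in one-based notation.
  A measured signal is a function \<open>w k :: nat \<Rightarrow> real\<close> of time, used only at times \<open>1, \<dots>, N\<close>.
\<close>

text \<open>Meaningful for invertible matrices only; otherwise the value is unspecified.\<close>

definition mat_inv :: "real mat \<Rightarrow> real mat" where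
  "mat_inv A = the (mat_inverse A)"

definition mat_trace :: "real mat \<Rightarrow> real" where
  "mat_trace A = sum_list (diag_mat A)"

definition hcat :: "nat \<Rightarrow> real mat list \<Rightarrow> real mat" where
  "hcat n As = mat_of_cols n (concat (map cols As))"

definition outer_prod :: "real vec \<Rightarrow> real mat" where
  "outer_prod v = mat_of_cols (dim_vec v) [v] * mat_of_rows (dim_vec v) [v]"

text \<open>The \<open>q\<close>-th (from 0) of the consecutive \<open>l \<times> l\<close> diagonal blocks.\<close>

definition diag_block :: "nat \<Rightarrow> nat \<Rightarrow> real mat \<Rightarrow> real mat" where
  "diag_block l q M = mat l l (\<lambda>(x, y). M $$ (q * l + x, q * l + y))"

definition toeplitz :: "nat \<Rightarrow> real vec \<Rightarrow> real mat" where
  "toeplitz r x = mat (dim_vec x) r (\<lambda>(s, t). if t \<le> s then x $ (s - t) else 0)"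

definition signal_vec :: "(nat \<Rightarrow> nat \<Rightarrow> real) \<Rightarrow> nat \<Rightarrow> nat \<Rightarrow> real vec" where
  "signal_vec w N k = vec N (\<lambda>s. w k (s + 1))"

definition delayed_vec :: "(nat \<Rightarrow> nat \<Rightarrow> real) \<Rightarrow> nat \<Rightarrow> nat \<Rightarrow> real vec" where
  "delayed_vec w N k = vec N (\<lambda>s. if s = 0 then 0 else w k s)"

definition neg_delayed2_vec :: "(nat \<Rightarrow> nat \<Rightarrow> real) \<Rightarrow> nat \<Rightarrow> nat \<Rightarrow> real vec" where
  "neg_delayed2_vec w N k = vec N (\<lambda>s. if s < 2 then 0 else - w k (s - 1))"

definition W_mat :: "(nat \<Rightarrow> nat \<Rightarrow> real) \<Rightarrow> nat \<Rightarrow> nat \<Rightarrow> nat \<Rightarrow> real mat" where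
  "W_mat w N l k = toeplitz l (delayed_vec w N k)"

definition W_arrow_mat :: "(nat \<Rightarrow> nat \<Rightarrow> real) \<Rightarrow> nat \<Rightarrow> nat \<Rightarrow> nat \<Rightarrow> real mat" where
  "W_arrow_mat w N l k = toeplitz l (neg_delayed2_vec w N k)"

text \<open>
  The vector \<open>\<eta>\<close>: \<open>par_B\<close> and \<open>par_F\<close> are the two parts of \<open>\<theta>\<close>, \<open>par_lam\<close> and \<open>par_beta\<close> give the
  kernel scalings and decay rates of each node, \<open>par_var\<close> is the noise variance.
\<close>

record hyperparams =
  par_B :: "real vec"
  par_F :: "real vec"
  par_lam :: "nat \<Rightarrow> real"
  par_beta :: "nat \<Rightarrow> real"
  par_var :: real

definition admissible :: "nat \<Rightarrow> nat set \<Rightarrow> hyperparams \<Rightarrow> bool" where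
  "admissible N S \<eta> \<longleftrightarrow>
     dim_vec (par_B \<eta>) \<le> N \<and> dim_vec (par_F \<eta>) \<le> N \<and>
     (\<forall>k\<in>S. par_lam \<eta> k > 0 \<and> 0 < par_beta \<eta> k \<and> par_beta \<eta> k < 1) \<and> par_var \<eta> > 0"

definition zero_pad :: "nat \<Rightarrow> real vec \<Rightarrow> real vec" where
  "zero_pad N x = x @\<^sub>v 0\<^sub>v (N - dim_vec x)"

definition g_vec :: "nat \<Rightarrow> hyperparams \<Rightarrow> real vec" where
  "g_vec N \<eta> = zero_pad N (par_B \<eta>) @\<^sub>v zero_pad N (par_F \<eta>)"

definition W_tilde ::
  "(nat \<Rightarrow> nat \<Rightarrow> real) \<Rightarrow> nat \<Rightarrow> nat \<Rightarrow> nat \<Rightarrow> nat \<Rightarrow> hyperparams \<Rightarrow> real mat" where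
  "W_tilde w N l i j \<eta> =
     W_mat w N l j + toeplitz N (zero_pad N (par_B \<eta>)) * W_arrow_mat w N l i
       - toeplitz N (zero_pad N (par_F \<eta>)) * W_arrow_mat w N l j"

definition W_ji :: "(nat \<Rightarrow> nat \<Rightarrow> real) \<Rightarrow> nat \<Rightarrow> nat \<Rightarrow> nat \<Rightarrow> real mat" where
  "W_ji w N i j = hcat N [W_mat w N N i, - W_mat w N N j]"

definition W_full ::
  "(nat \<Rightarrow> nat \<Rightarrow> real) \<Rightarrow> nat \<Rightarrow> nat \<Rightarrow> nat \<Rightarrow> nat \<Rightarrow> nat list \<Rightarrow> hyperparams \<Rightarrow> real mat" where
  "W_full w N l i j ks \<eta> = hcat N (W_tilde w N l i j \<eta> # map (W_mat w N l) ks)"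

definition K_mat :: "nat \<Rightarrow> real \<Rightarrow> real mat" where
  "K_mat l \<beta> = mat l l (\<lambda>(x, y). \<beta> ^ max (x + 1) (y + 1))"

definition K_full :: "nat \<Rightarrow> nat \<Rightarrow> nat list \<Rightarrow> hyperparams \<Rightarrow> real mat" where
  "K_full l j ks \<eta> = diag_block_mat (map (\<lambda>k. par_lam \<eta> k \<cdot>\<^sub>m K_mat l (par_beta \<eta> k)) (j # ks))"

text \<open>
  Covariance and mean of \<open>m\<close> given \<open>w\<^sub>j\<close> in the model \<open>w\<^sub>j = W m + W\<^sub>j\<^sub>i g + e\<close> with independent
  \<open>m \<sim> N(0, K)\<close> and \<open>e \<sim> N(0, \<sigma>\<^sup>2 I)\<close>.
\<close>

definition post_cov ::
  "(nat \<Rightarrow> nat \<Rightarrow> real) \<Rightarrow> nat \<Rightarrow> nat \<Rightarrow> nat \<Rightarrow> nat \<Rightarrow> nat list \<Rightarrow> hyperparams \<Rightarrow> real mat" where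
  "post_cov w N l i j ks \<eta> =
     (let W = W_full w N l i j ks \<eta>
      in mat_inv ((1 / par_var \<eta>) \<cdot>\<^sub>m (transpose_mat W * W) + mat_inv (K_full l j ks \<eta>)))"

definition post_mean ::
  "(nat \<Rightarrow> nat \<Rightarrow> real) \<Rightarrow> nat \<Rightarrow> nat \<Rightarrow> nat \<Rightarrow> nat \<Rightarrow> nat list \<Rightarrow> hyperparams \<Rightarrow> real vec" where
  "post_mean w N l i j ks \<eta> =
     (1 / par_var \<eta>) \<cdot>\<^sub>v
       (post_cov w N l i j ks \<eta> *\<^sub>v
         (transpose_mat (W_full w N l i j ks \<eta>) *\<^sub>v
           (signal_vec w N j - W_ji w N i j *\<^sub>v g_vec N \<eta>)))"

definition M_hat ::
  "(nat \<Rightarrow> nat \<Rightarrow> real) \<Rightarrow> nat \<Rightarrow> nat \<Rightarrow> nat \<Rightarrow> nat \<Rightarrow> nat list \<Rightarrow> hyperparams \<Rightarrow> real mat" where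
  "M_hat w N l i j ks \<eta> = post_cov w N l i j ks \<eta> + outer_prod (post_mean w N l i j ks \<eta>)"

definition Q_m :: "nat \<Rightarrow> real mat \<Rightarrow> real \<Rightarrow> real \<Rightarrow> real" where
  "Q_m l M lam \<beta> = - ln (det (lam \<cdot>\<^sub>m K_mat l \<beta>)) - mat_trace (mat_inv (lam \<cdot>\<^sub>m K_mat l \<beta>) * M)"

definition Q_beta :: "nat \<Rightarrow> real mat \<Rightarrow> real \<Rightarrow> real" where
  "Q_beta l M \<beta> = ln (det (K_mat l \<beta>)) + real l * ln (mat_trace (mat_inv (K_mat l \<beta>) * M))"

end

theory Submission
  imports Defs
begin

text \<open>
  Write \<open>T(\<beta>) = tr(K\<^sub>\<beta>\<^sup>-\<^sup>1 M)\<close>. For fixed \<open>\<beta>\<close>, \<open>Q\<^sub>m(\<lambda>, \<beta>) = - l ln \<lambda> - ln det K\<^sub>\<beta> - T(\<beta>)/\<lambda>\<close>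
  is largest at \<open>\<lambda> = T(\<beta>)/l\<close>, where it equals \<open>- Q\<^sub>\<beta>(\<beta>) + l ln l - l\<close>. This needs
  \<open>det K\<^sub>\<beta> > 0\<close> and \<open>T(\<beta>) > 0\<close>. The former comes from the factorization
  \<open>K\<^sub>\<beta> = U D U\<^sup>T\<close> with \<open>U\<close> the upper triangular matrix of ones and \<open>D\<close> diagonal and positive;
  the latter also uses that \<open>M\<close> is positive definite, as a diagonal block of the sum of a
  positive definite posterior covariance and a positive semidefinite rank-one matrix.
\<close>

section \<open>Positive definite matrices\<close>

text \<open>Symmetry is not part of the definition: inverses, blocks and congruences preserve positivity
  of the quadratic form without it.\<close>

definition pos_def_mat :: "nat \<Rightarrow> real mat \<Rightarrow> bool" where
  "pos_def_mat n A \<longleftrightarrow>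
     A \<in> carrier_mat n n \<and> (\<forall>v\<in>carrier_vec n. v \<noteq> 0\<^sub>v n \<longrightarrow> v \<bullet> (A *\<^sub>v v) > 0)"

lemma pos_def_matD:
  assumes "pos_def_mat n A"
  shows "A \<in> carrier_mat n n"
    and "\<And>v. v \<in> carrier_vec n \<Longrightarrow> v \<noteq> 0\<^sub>v n \<Longrightarrow> v \<bullet> (A *\<^sub>v v) > 0"
  using assms unfolding pos_def_mat_def by auto

lemma pos_def_mat_nonneg:
  assumes "pos_def_mat n A" "v \<in> carrier_vec n"
  shows "v \<bullet> (A *\<^sub>v v) \<ge> 0"
proof (cases "v = 0\<^sub>v n")
  case True
  have "0\<^sub>v n \<bullet> (A *\<^sub>v v) = 0"
    by (rule scalar_prod_left_zero) (use pos_def_matD(1)[OF assms(1)] assms(2) in auto)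
  then show ?thesis using True by simp
next
  case False
  then show ?thesis using pos_def_matD(2)[OF assms(1,2)] by simp
qed

text \<open>\<open>mat_inverse\<close> yields \<open>None\<close> only for non-units of the matrix
  ring, and a nonzero determinant makes \<open>A\<close> a unit; hence the \<open>the\<close> in
  \<open>mat_inv\<close> is well defined here.\<close>

lemma mat_inv_left_right:
  assumes A: "A \<in> carrier_mat n n" and det: "det A \<noteq> 0"
  shows "mat_inv A \<in> carrier_mat n n" "A * mat_inv A = 1\<^sub>m n" "mat_inv A * A = 1\<^sub>m n"
proof -
  have "mat_inverse A \<noteq> None"
    using mat_inverse(1)[OF A, of undefined] det_non_zero_imp_unit[OF A det, of undefined] by blast
  then obtain B where B: "mat_inverse A = Some B" by auto
  with mat_inverse(2)[OF A B]
  show "mat_inv A \<in> carrier_mat n n" "A * mat_inv A = 1\<^sub>m n" "mat_inv A * A = 1\<^sub>m n"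
    unfolding mat_inv_def by auto
qed

text \<open>Taking determinants in \<open>B * A = 1\<close> makes \<open>A\<close> invertible, and
  then B = (B A) A^-1 up to associativity. This allows explicit inverses to be verified from one
  side only.\<close>

lemma mat_inv_unique:
  assumes A: "A \<in> carrier_mat n n" and B: "B \<in> carrier_mat n n" and BA: "B * A = 1\<^sub>m n"
  shows "mat_inv A = B"
proof -
  have "det B * det A = 1" using det_mult[OF B A] BA by simp
  then have "det A \<noteq> 0" by auto
  note inv = mat_inv_left_right[OF A this]
  have "mat_inv A = (B * A) * mat_inv A" using inv BA by simp
  also have "\<dots> = B * (A * mat_inv A)" using assoc_mult_mat[OF B A inv(1)] .
  finally show ?thesis using inv B by simp
qed

lemma mult_mat_zero_vec:
  assumes "(A :: 'a :: semiring_0 mat) \<in> carrier_mat n m"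
  shows "A *\<^sub>v 0\<^sub>v m = 0\<^sub>v n"
  using assms by (intro eq_vecI) (auto simp: scalar_prod_def)

text \<open>A singular matrix has a nonzero kernel vector, and the quadratic form vanishes on
  it.\<close>

lemma pos_def_mat_det_nonzero:
  assumes "pos_def_mat n A"
  shows "det A \<noteq> 0"
proof
  assume "det A = 0"
  then obtain v where v: "v \<in> carrier_vec n" "v \<noteq> 0\<^sub>v n" "A *\<^sub>v v = 0\<^sub>v n"
    using det_0_iff_vec_prod_zero[OF pos_def_matD(1)[OF assms]] by auto
  have "v \<bullet> (A *\<^sub>v v) = 0" using v by (simp add: scalar_prod_right_zero)
  then show False using pos_def_matD(2)[OF assms v(1,2)] by simp
qed

text \<open>With y = A^-1 v the form v . A^-1 v becomes (A y) . y, so only commutativity of the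
  scalar product enters, not symmetry of \<open>A\<close>.\<close>

lemma pos_def_mat_inv:
  assumes P: "pos_def_mat n A"
  shows "pos_def_mat n (mat_inv A)"
  unfolding pos_def_mat_def
proof (intro conjI ballI impI)
  note A = pos_def_matD(1)[OF P]
  note inv = mat_inv_left_right[OF A pos_def_mat_det_nonzero[OF P]]
  show "mat_inv A \<in> carrier_mat n n" by (fact inv(1))
  fix v :: "real vec" assume v: "v \<in> carrier_vec n" "v \<noteq> 0\<^sub>v n"
  define y where "y = mat_inv A *\<^sub>v v"
  have y: "y \<in> carrier_vec n" using inv v y_def by simp
  have Ay: "A *\<^sub>v y = v"
    using assoc_mult_mat_vec[OF A inv(1) v(1)] inv(2) v(1) unfolding y_def by simp
  have "y \<noteq> 0\<^sub>v n"
  proof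
    assume "y = 0\<^sub>v n"
    then have "A *\<^sub>v y = 0\<^sub>v n" using mult_mat_zero_vec[OF A] by simp
    with Ay v show False by simp
  qed
  then have "y \<bullet> (A *\<^sub>v y) > 0" using pos_def_matD(2)[OF P y] by simp
  then show "v \<bullet> (mat_inv A *\<^sub>v v) > 0"
    unfolding Ay y_def[symmetric] using comm_scalar_prod[OF y v(1)] by simp
qed

lemma pos_def_mat_add_semidef:
  assumes P: "pos_def_mat n A" and B: "B \<in> carrier_mat n n"
    and nn: "\<And>v. v \<in> carrier_vec n \<Longrightarrow> v \<bullet> (B *\<^sub>v v) \<ge> 0"
  shows "pos_def_mat n (A + B)"
  unfolding pos_def_mat_def
proof (intro conjI ballI impI)
  note A = pos_def_matD(1)[OF P]
  show "A + B \<in> carrier_mat n n" using A B by simp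
  fix v :: "real vec" assume v: "v \<in> carrier_vec n" "v \<noteq> 0\<^sub>v n"
  have "v \<bullet> ((A + B) *\<^sub>v v) = v \<bullet> (A *\<^sub>v v) + v \<bullet> (B *\<^sub>v v)"
    using add_mult_distrib_mat_vec[OF A B v(1)]
      scalar_prod_add_distrib[of v n "A *\<^sub>v v" "B *\<^sub>v v"] v A B by simp
  then show "v \<bullet> ((A + B) *\<^sub>v v) > 0"
    using pos_def_matD(2)[OF P v] nn[OF v(1)] by linarith
qed

section \<open>Congruences, scalings and diagonal matrices\<close>

lemma congruence_quadratic_form:
  assumes A: "A \<in> carrier_mat n n" and S: "S \<in> carrier_mat n l" and v: "v \<in> carrier_vec l"
  shows "v \<bullet> ((transpose_mat S * (A * S)) *\<^sub>v v) = (S *\<^sub>v v) \<bullet> (A *\<^sub>v (S *\<^sub>v v :: real vec))"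
proof -
  have St: "transpose_mat S \<in> carrier_mat l n" using S by simp
  have Sv: "S *\<^sub>v v \<in> carrier_vec n" using S v by simp
  have "(transpose_mat S * (A * S)) *\<^sub>v v = transpose_mat S *\<^sub>v ((A * S) *\<^sub>v v)"
    by (rule assoc_mult_mat_vec[OF St _ v]) (use A S in simp)
  also have "(A * S) *\<^sub>v v = A *\<^sub>v (S *\<^sub>v v)" by (rule assoc_mult_mat_vec[OF A S v])
  finally have eq: "(transpose_mat S * (A * S)) *\<^sub>v v = transpose_mat S *\<^sub>v (A *\<^sub>v (S *\<^sub>v v))" .
  show ?thesis unfolding eq
    using transpose_vec_mult_scalar[OF St, of "A *\<^sub>v (S *\<^sub>v v)" v] A Sv v by simp
qed

text \<open>Injectivity of \<open>S\<close> keeps S v nonzero. \<open>S\<close> may be rectangular,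
  so this covers both the factorization of the kernel and the restriction to a diagonal
  block.\<close>

lemma pos_def_mat_congruence:
  assumes P: "pos_def_mat n A" and S: "S \<in> carrier_mat n l"
    and inj: "\<And>v. v \<in> carrier_vec l \<Longrightarrow> S *\<^sub>v v = 0\<^sub>v n \<Longrightarrow> v = 0\<^sub>v l"
  shows "pos_def_mat l (transpose_mat S * (A * S))"
  unfolding pos_def_mat_def
proof (intro conjI ballI impI)
  note A = pos_def_matD(1)[OF P]
  show "transpose_mat S * (A * S) \<in> carrier_mat l l" using A S by simp
  fix v :: "real vec" assume v: "v \<in> carrier_vec l" "v \<noteq> 0\<^sub>v l"
  have "S *\<^sub>v v \<noteq> 0\<^sub>v n" using inj v by blast
  then show "v \<bullet> ((transpose_mat S * (A * S)) *\<^sub>v v) > 0"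
    unfolding congruence_quadratic_form[OF A S v(1)]
    using pos_def_matD(2)[OF P] S v by simp
qed

lemma smult_mat_mult_vec:
  assumes "(A :: 'a :: comm_semiring_0 mat) \<in> carrier_mat n m" "v \<in> carrier_vec m"
  shows "(c \<cdot>\<^sub>m A) *\<^sub>v v = c \<cdot>\<^sub>v (A *\<^sub>v v)"
  using assms by (intro eq_vecI) auto

lemma pos_def_mat_smult:
  assumes P: "pos_def_mat n A" and c: "c > 0"
  shows "pos_def_mat n (c \<cdot>\<^sub>m A)"
  unfolding pos_def_mat_def
proof (intro conjI ballI impI)
  note A = pos_def_matD(1)[OF P]
  show "c \<cdot>\<^sub>m A \<in> carrier_mat n n" using A by simp
  fix v :: "real vec" assume v: "v \<in> carrier_vec n" "v \<noteq> 0\<^sub>v n"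
  have "(c \<cdot>\<^sub>m A) *\<^sub>v v = c \<cdot>\<^sub>v (A *\<^sub>v v)"
    using smult_mat_mult_vec[OF A v(1)] by simp
  then have "v \<bullet> ((c \<cdot>\<^sub>m A) *\<^sub>v v) = c * (v \<bullet> (A *\<^sub>v v))"
    using v A by simp
  then show "v \<bullet> ((c \<cdot>\<^sub>m A) *\<^sub>v v) > 0" using pos_def_matD(2)[OF P v] c by simp
qed

lemma pos_def_mat_diag:
  assumes d: "\<And>x. x < n \<Longrightarrow> d x > 0"
  shows "pos_def_mat n (mat_diag n d)"
  unfolding pos_def_mat_def
proof (intro conjI ballI impI)
  show "mat_diag n d \<in> carrier_mat n n" by simp
  fix v :: "real vec" assume v: "v \<in> carrier_vec n" "v \<noteq> 0\<^sub>v n"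
  then obtain x where x: "x < n" "v $ x \<noteq> 0" by (metis carrier_vecD eq_vecI index_zero_vec)
  have dv: "(mat_diag n d *\<^sub>v v) $ y = d y * v $ y" if "y < n" for y
  proof -
    have "(mat_diag n d *\<^sub>v v) $ y = (\<Sum>z<n. (if y = z then d z else 0) * v $ z)"
      using v that by (simp add: mat_diag_def scalar_prod_def lessThan_atLeast0)
    also have "\<dots> = (\<Sum>z<n. (if y = z then d z * v $ z else 0))"
      by (intro sum.cong) auto
    finally show ?thesis using that by simp
  qed
  have "v \<bullet> (mat_diag n d *\<^sub>v v) = (\<Sum>y<n. d y * (v $ y)\<^sup>2)"
    using v mat_diag_dim[of n d] carrier_matD[OF mat_diag_dim[of n d]] dv
    unfolding scalar_prod_def
    by (auto simp: lessThan_atLeast0 power2_eq_square simp del: mat_diag_dim intro!: sum.cong)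
  also have "\<dots> > 0"
    \<comment> \<open>All terms are nonnegative, and the one at the nonzero coordinate
      \<open>x\<close> is positive.\<close>
    by (rule sum_pos2[of _ x]) (use x d in \<open>auto simp: less_imp_le\<close>)
  finally show "v \<bullet> (mat_diag n d *\<^sub>v v) > 0" .
qed

section \<open>Assembling and extracting diagonal blocks\<close>

lemma append_vec_zero: "0\<^sub>v m @\<^sub>v 0\<^sub>v n = (0\<^sub>v (m + n) :: 'a :: zero vec)"
  by (intro eq_vecI) auto

text \<open>Splitting v into its first m and last n coordinates splits the form into two nonnegative
  summands; as v is nonzero, at least one part is nonzero and its summand positive.\<close>

lemma pos_def_four_block:
  assumes P: "pos_def_mat m A" and Q: "pos_def_mat n B"
  shows "pos_def_mat (m + n) (four_block_mat A (0\<^sub>m m n) (0\<^sub>m n m) B)"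
  unfolding pos_def_mat_def
proof (intro conjI ballI impI)
  note A = pos_def_matD(1)[OF P] and B = pos_def_matD(1)[OF Q]
  show "four_block_mat A (0\<^sub>m m n) (0\<^sub>m n m) B \<in> carrier_mat (m + n) (m + n)"
    using A B by simp
  fix v :: "real vec" assume v: "v \<in> carrier_vec (m + n)" "v \<noteq> 0\<^sub>v (m + n)"
  define a d where "a = vec_first v m" and "d = vec_last v n"
  have a: "a \<in> carrier_vec m" and d: "d \<in> carrier_vec n" and vad: "v = a @\<^sub>v d"
    using v unfolding a_def d_def by auto
  have "four_block_mat A (0\<^sub>m m n) (0\<^sub>m n m) B *\<^sub>v v = (A *\<^sub>v a) @\<^sub>v (B *\<^sub>v d)"
    unfolding vad by (rule mult_mat_vec_split[OF A B a d])
  then have eq: "v \<bullet> (four_block_mat A (0\<^sub>m m n) (0\<^sub>m n m) B *\<^sub>v v) = a \<bullet> (A *\<^sub>v a) + d \<bullet> (B *\<^sub>v d)"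
    unfolding vad using scalar_prod_append[OF a d, of "A *\<^sub>v a" "B *\<^sub>v d"] A B a d by simp
  have "a \<noteq> 0\<^sub>v m \<or> d \<noteq> 0\<^sub>v n" using v(2) append_vec_zero unfolding vad by auto
  then show "v \<bullet> (four_block_mat A (0\<^sub>m m n) (0\<^sub>m n m) B *\<^sub>v v) > 0"
    unfolding eq using pos_def_matD(2)[OF P a] pos_def_matD(2)[OF Q d]
      pos_def_mat_nonneg[OF P a] pos_def_mat_nonneg[OF Q d] by fastforce
qed

lemma pos_def_diag_block_mat:
  assumes "\<And>A. A \<in> set As \<Longrightarrow> pos_def_mat l A"
  shows "pos_def_mat (length As * l) (diag_block_mat As)"
  using assms
proof (induction As)
  case Nil
  \<comment> \<open>In dimension 0 there is no nonzero vector, so positivity is vacuous.\<close>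
  show ?case by (auto simp: pos_def_mat_def)
next
  case (Cons A As)
  have A: "pos_def_mat l A" and B: "pos_def_mat (length As * l) (diag_block_mat As)"
    using Cons by auto
  show ?case
    using pos_def_four_block[OF A B] pos_def_matD(1)[OF A] pos_def_matD(1)[OF B]
    by (simp add: Let_def)
qed

text \<open>The block is the congruence S^T M S with the selector \<open>S\<close> whose x-th column
  is the unit vector at position \<open>q * l + x\<close>.\<close>

lemma pos_def_diag_block:
  assumes P: "pos_def_mat n M" and q: "q * l + l \<le> n"
  shows "pos_def_mat l (diag_block l q M)"
proof -
  note M = pos_def_matD(1)[OF P]
  define S :: "real mat" where "S = mat n l (\<lambda>(a, x). if a = q * l + x then 1 else 0)"
  have S: "S \<in> carrier_mat n l" by (simp add: S_def)
  have lt: "q * l + x < n" if "x < l" for x using that q by simp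
  have col: "col S x = unit_vec n (q * l + x)" if "x < l" for x
    using that by (intro eq_vecI) (auto simp: S_def unit_vec_def)
  have row: "row S (q * l + x) = unit_vec l x" if "x < l" for x
    using that lt by (intro eq_vecI) (auto simp: S_def unit_vec_def)
  have "diag_block l q M = transpose_mat S * (M * S)"
  proof (rule eq_matI)
    fix x y assume "x < dim_row (transpose_mat S * (M * S))" "y < dim_col (transpose_mat S * (M * S))"
    then have xy: "x < l" "y < l" using S by auto
    have "(transpose_mat S * (M * S)) $$ (x, y) = col S x \<bullet> col (M * S) y"
      using xy S M by simp
    also have "col (M * S) y = M *\<^sub>v col S y" using xy S M by (intro eq_vecI) auto
    also have "\<dots> = col M (q * l + y)"
      unfolding col[OF xy(2)] using M lt[OF xy(2)] by (intro eq_vecI) auto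
    also have "col S x \<bullet> col M (q * l + y) = col M (q * l + y) $ (q * l + x)"
      unfolding col[OF xy(1)] by (rule scalar_prod_left_unit) (use lt[OF xy(1)] M in auto)
    also have "\<dots> = M $$ (q * l + x, q * l + y)" using lt xy M by simp
    finally show "diag_block l q M $$ (x, y) = (transpose_mat S * (M * S)) $$ (x, y)"
      using xy by (simp add: diag_block_def)
  qed (use S in \<open>auto simp: diag_block_def\<close>)
  \<comment> \<open>\<open>S\<close> copies v into the coordinates from \<open>q * l\<close> on, so
    v can be read off from S v.\<close>
  moreover have "v = 0\<^sub>v l" if v: "v \<in> carrier_vec l" "S *\<^sub>v v = 0\<^sub>v n" for v
  proof (rule eq_vecI)
    fix x assume "x < dim_vec (0\<^sub>v l :: real vec)"
    then have x: "x < l" by simp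
    have "(S *\<^sub>v v) $ (q * l + x) = unit_vec l x \<bullet> v"
      using S lt[OF x] row[OF x] by (simp del: scalar_prod_left_unit)
    then have "(S *\<^sub>v v) $ (q * l + x) = v $ x"
      using scalar_prod_left_unit[OF v(1) x] by simp
    then show "v $ x = (0\<^sub>v l :: real vec) $ x" using v lt[OF x] x by simp
  qed (use v in auto)
  ultimately show ?thesis using pos_def_mat_congruence[OF P S] by simp
qed

text \<open>Since (u u^T) v = (u . v) u, the rank-one form is a square and hence
  nonnegative.\<close>

lemma outer_prod_quadratic_form:
  assumes u: "u \<in> carrier_vec n" and v: "v \<in> carrier_vec n"
  shows "outer_prod u \<in> carrier_mat n n" "v \<bullet> (outer_prod u *\<^sub>v v) = (u \<bullet> v)\<^sup>2"
proof -
  have d: "dim_vec u = n" using u by simp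
  have c: "mat_of_cols n [u] \<in> carrier_mat n 1" "mat_of_rows n [u] \<in> carrier_mat 1 n"
    using mat_of_cols_carrier(1)[of n "[u]"] mat_of_rows_carrier(1)[of n "[u]"] by auto
  then show "outer_prod u \<in> carrier_mat n n" unfolding outer_prod_def d by simp
  have "outer_prod u *\<^sub>v v = mat_of_cols n [u] *\<^sub>v (mat_of_rows n [u] *\<^sub>v v)"
    unfolding outer_prod_def d by (rule assoc_mult_mat_vec[OF c v])
  also have "\<dots> = (u \<bullet> v) \<cdot>\<^sub>v u"
    using u v
    by (intro eq_vecI) (auto simp: scalar_prod_def mat_of_cols_def mat_of_rows_def mult.commute)
  finally show "v \<bullet> (outer_prod u *\<^sub>v v) = (u \<bullet> v)\<^sup>2"
    using u v comm_scalar_prod[OF u v] by (simp add: power2_eq_square)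
qed

section \<open>The stable spline kernel\<close>

definition upper_ones :: "nat \<Rightarrow> real mat" where
  "upper_ones l = mat l l (\<lambda>(x, y). if x \<le> y then 1 else 0)"

text \<open>The diagonal of D in K = U D U^T: successive differences of the powers of \<beta>,
  except that the last entry, at m = l - 1, is the full power \<beta>^l. This makes the tail sums
  telescope.\<close>

definition kernel_diag :: "nat \<Rightarrow> real \<Rightarrow> nat \<Rightarrow> real" where
  "kernel_diag l \<beta> m = \<beta> ^ Suc m - (if Suc m < l then \<beta> ^ Suc (Suc m) else 0)"

lemma kernel_diag_pos:
  assumes "0 < \<beta>" "\<beta> < 1"
  shows "kernel_diag l \<beta> m > 0"
proof -
  have "\<beta> ^ Suc (Suc m) < \<beta> ^ Suc m" using assms by (intro power_strict_decreasing) auto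
  then show ?thesis using assms by (simp add: kernel_diag_def)
qed

lemma upper_ones_carrier [simp]: "upper_ones l \<in> carrier_mat l l"
  by (simp add: upper_ones_def)

lemma det_upper_ones: "det (upper_ones l) = 1"
proof -
  have "upper_triangular (upper_ones l)" by (auto simp: upper_triangular_def upper_ones_def)
  then have "det (upper_ones l) = prod_list (diag_mat (upper_ones l))"
    by (rule det_upper_triangular[of _ l]) simp
  also have "\<dots> = 1" unfolding prod_list_diag_prod by (auto simp: upper_ones_def)
  finally show ?thesis .
qed

lemma sum_kernel_diag:
  assumes "x < l"
  shows "(\<Sum>m = x..<l. kernel_diag l \<beta> m) = \<beta> ^ Suc x"
proof -
  have "(\<Sum>m = x..<l. kernel_diag l \<beta> m)
      = (\<Sum>m = x..<l. (if m < l then \<beta> ^ Suc m else 0) - (if Suc m < l then \<beta> ^ Suc (Suc m) else 0))"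
    by (intro sum.cong) (auto simp: kernel_diag_def)
  also have "\<dots> = (if x < l then \<beta> ^ Suc x else 0)"
    using sum_Suc_diff'[of x l "\<lambda>m. - (if m < l then \<beta> ^ Suc m else 0)"] assms by simp
  finally show ?thesis using assms by simp
qed

lemma K_mat_carrier [simp]: "K_mat l \<beta> \<in> carrier_mat l l"
  by (simp add: K_mat_def)

text \<open>Entry (x, y) of U D U^T sums the diagonal over all m that are at least both x and y.
  This tail sum is the power of \<beta> with exponent max x y + 1, the shift coming from indices
  starting at 0.\<close>

lemma K_mat_factorization:
  "K_mat l \<beta> = upper_ones l * (mat_diag l (kernel_diag l \<beta>) * transpose_mat (upper_ones l))"
proof (rule eq_matI)
  let ?U = "upper_ones l" and ?d = "kernel_diag l \<beta>"
  fix x y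
  assume "x < dim_row (?U * (mat_diag l ?d * transpose_mat ?U))"
    "y < dim_col (?U * (mat_diag l ?d * transpose_mat ?U))"
  then have xy: "x < l" "y < l" by (auto simp: upper_ones_def)
  have DU: "mat_diag l ?d * transpose_mat ?U = mat l l (\<lambda>(m, y). ?d m * transpose_mat ?U $$ (m, y))"
    by (rule mat_diag_mult_left) simp
  have "(?U * (mat_diag l ?d * transpose_mat ?U)) $$ (x, y)
      = (\<Sum>m = 0..<l. if max x y \<le> m then ?d m else 0)"
    unfolding DU using xy by (auto simp: upper_ones_def scalar_prod_def intro!: sum.cong)
  also have "\<dots> = (\<Sum>m \<in> {m \<in> {0..<l}. max x y \<le> m}. ?d m)"
    by (rule sum.inter_filter[symmetric]) simp
  also have "{m \<in> {0..<l}. max x y \<le> m} = {max x y..<l}" by auto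
  also have "(\<Sum>m = max x y..<l. ?d m) = \<beta> ^ Suc (max x y)"
    by (rule sum_kernel_diag) (use xy in simp)
  finally show "K_mat l \<beta> $$ (x, y) = (?U * (mat_diag l ?d * transpose_mat ?U)) $$ (x, y)"
    using xy by (simp add: K_mat_def max_def)
qed (auto simp: K_mat_def upper_ones_def)

text \<open>\<open>U\<close> has determinant 1, so the determinant is the product of the positive
  entries of \<open>kernel_diag\<close>.\<close>

lemma det_K_mat_pos:
  assumes "0 < \<beta>" "\<beta> < 1"
  shows "det (K_mat l \<beta>) > 0"
proof -
  let ?U = "upper_ones l" and ?D = "mat_diag l (kernel_diag l \<beta>)"
  have "det (K_mat l \<beta>) = det ?U * (det ?D * det (transpose_mat ?U))"
    unfolding K_mat_factorization
    using det_mult[of ?U l "?D * transpose_mat ?U"] det_mult[of ?D l "transpose_mat ?U"]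
      mult_carrier_mat[of ?D l l "transpose_mat ?U" l] by simp
  also have "\<dots> = det ?D" using det_transpose[OF upper_ones_carrier] det_upper_ones by simp
  also have "det ?D = prod_list (diag_mat ?D)"
    by (rule det_upper_triangular[of _ l]) (auto simp: upper_triangular_def mat_diag_def)
  also have "\<dots> > 0"
    unfolding prod_list_diag_prod
    by (intro prod_pos) (auto simp: mat_diag_def kernel_diag_pos assms)
  finally show ?thesis .
qed

lemma inj_of_left_inverse:
  assumes A: "(A :: 'a :: comm_ring_1 mat) \<in> carrier_mat n n" and B: "B \<in> carrier_mat n n"
    and BA: "B * A = 1\<^sub>m n"
    and v: "v \<in> carrier_vec n" "A *\<^sub>v v = 0\<^sub>v n"
  shows "v = 0\<^sub>v n"
proof -
  have "v = (B * A) *\<^sub>v v" using BA v by simp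
  also have "\<dots> = B *\<^sub>v 0\<^sub>v n" using assoc_mult_mat_vec[OF B A v(1)] v(2) by simp
  also have "\<dots> = 0\<^sub>v n" by (rule mult_mat_zero_vec[OF B])
  finally show ?thesis .
qed

lemma pos_def_K_mat:
  assumes "0 < \<beta>" "\<beta> < 1"
  shows "pos_def_mat l (K_mat l \<beta>)"
proof -
  let ?T = "transpose_mat (upper_ones l)"
  have T: "?T \<in> carrier_mat l l" by simp
  have "det ?T \<noteq> 0" using det_transpose[OF upper_ones_carrier] det_upper_ones by simp
  note inv = mat_inv_left_right[OF T this]
  \<comment> \<open>The congruence is taken with S = U^T, whose transpose is U again.\<close>
  have "pos_def_mat l (transpose_mat ?T * (mat_diag l (kernel_diag l \<beta>) * ?T))"
    by (rule pos_def_mat_congruence[OF pos_def_mat_diag T inj_of_left_inverse[OF T inv(1,3)]])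
      (use kernel_diag_pos assms in auto)
  then show ?thesis by (simp add: K_mat_factorization)
qed

section \<open>Traces and the inverse kernel\<close>

lemma mat_trace_eq_sum: "A \<in> carrier_mat n m \<Longrightarrow> mat_trace A = (\<Sum>x<n. A $$ (x, x))"
  by (auto simp: mat_trace_def diag_mat_def interv_sum_list_conv_sum_set_nat lessThan_atLeast0)

lemma mat_trace_mult_commute:
  assumes A: "A \<in> carrier_mat n m" and B: "B \<in> carrier_mat m n"
  shows "mat_trace (A * B) = mat_trace (B * A)"
proof -
  have "mat_trace (A * B) = (\<Sum>x<n. \<Sum>y<m. A $$ (x, y) * B $$ (y, x))"
    using A B by (subst mat_trace_eq_sum[of _ n n]) (auto simp: scalar_prod_def lessThan_atLeast0)
  also have "\<dots> = (\<Sum>y<m. \<Sum>x<n. A $$ (x, y) * B $$ (y, x))" by (rule sum.swap)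
  also have "\<dots> = mat_trace (B * A)"
    using A B by (subst mat_trace_eq_sum[of _ m m])
      (auto simp: scalar_prod_def lessThan_atLeast0 mult.commute)
  finally show ?thesis .
qed

text \<open>With \<open>V = U\<^sup>-\<^sup>1\<close> one has \<open>K\<^sup>-\<^sup>1 = V\<^sup>T D\<^sup>-\<^sup>1 V\<close>, so by cyclicity the trace is that of
  \<open>D\<^sup>-\<^sup>1 (V M V\<^sup>T)\<close>, whose diagonal entries are positive.\<close>

lemma trace_inv_K_mat_pos:
  assumes \<beta>: "0 < \<beta>" "\<beta> < 1" and l: "l > 0" and P: "pos_def_mat l M"
  shows "mat_trace (mat_inv (K_mat l \<beta>) * M) > 0"
proof -
  let ?U = "upper_ones l" and ?d = "kernel_diag l \<beta>"
  define D D' where "D = mat_diag l ?d" and "D' = mat_diag l (\<lambda>m. 1 / ?d m)"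
  define V where "V = mat_inv ?U"
  define T where "T = transpose_mat V"
  note M = pos_def_matD(1)[OF P]
  have d: "?d m > 0" for m using kernel_diag_pos[OF \<beta>] .
  have U: "?U \<in> carrier_mat l l" by simp
  have D: "D \<in> carrier_mat l l" "D' \<in> carrier_mat l l" by (auto simp: D_def D'_def)
  have DD: "D' * D = 1\<^sub>m l" using d by (simp add: D_def D'_def less_imp_neq[symmetric])
  have "det ?U \<noteq> 0" by (simp add: det_upper_ones)
  note inv = mat_inv_left_right[OF U this, folded V_def]
  have T: "T \<in> carrier_mat l l" using inv by (simp add: T_def)
  have UT: "transpose_mat ?U \<in> carrier_mat l l" by simp
  have TU: "T * transpose_mat ?U = 1\<^sub>m l"
    unfolding T_def using transpose_mult[OF U inv(1)] inv(2) by simp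
  have UT': "transpose_mat ?U * T = 1\<^sub>m l"
    by (rule mat_mult_left_right_inverse[OF T UT TU])
  have KI: "mat_inv (K_mat l \<beta>) = T * (D' * V)"
  proof (rule mat_inv_unique)
    have DUT: "D * transpose_mat ?U \<in> carrier_mat l l" using D by simp
    \<comment> \<open>Cancelling \<open>V\<close> against U and then \<open>D'\<close> against
      \<open>D\<close> leaves U^T, which \<open>T\<close> inverts from the left.\<close>
    have "(D' * V) * (?U * (D * transpose_mat ?U)) = D' * (V * (?U * (D * transpose_mat ?U)))"
      by (rule assoc_mult_mat[OF D(2) inv(1) mult_carrier_mat[OF U DUT]])
    also have "V * (?U * (D * transpose_mat ?U)) = (V * ?U) * (D * transpose_mat ?U)"
      by (rule assoc_mult_mat[OF inv(1) U DUT, symmetric])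
    also have "\<dots> = D * transpose_mat ?U"
      unfolding inv(3) by (rule left_mult_one_mat[OF DUT])
    also have "D' * (D * transpose_mat ?U) = (D' * D) * transpose_mat ?U"
      by (rule assoc_mult_mat[OF D(2,1) UT, symmetric])
    also have "\<dots> = transpose_mat ?U" unfolding DD by (rule left_mult_one_mat[OF UT])
    finally have *: "(D' * V) * (?U * (D * transpose_mat ?U)) = transpose_mat ?U" .
    have "T * (D' * V) * K_mat l \<beta> = T * ((D' * V) * (?U * (D * transpose_mat ?U)))"
      unfolding K_mat_factorization D_def[symmetric]
      by (rule assoc_mult_mat[OF T _ mult_carrier_mat[OF U DUT]]) (use D inv in simp)
    then show "T * (D' * V) * K_mat l \<beta> = 1\<^sub>m l" unfolding * TU .
  qed (use T D inv in auto)
  have DV: "D' * V \<in> carrier_mat l l" and VMT: "V * (M * T) \<in> carrier_mat l l"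
    using D inv M T by auto
  have "mat_trace (mat_inv (K_mat l \<beta>) * M) = mat_trace (T * ((D' * V) * M))"
    unfolding KI using assoc_mult_mat[OF T DV M] by simp
  also have "\<dots> = mat_trace (((D' * V) * M) * T)"
    by (rule mat_trace_mult_commute[OF T]) (use DV M in simp)
  also have "((D' * V) * M) * T = (D' * V) * (M * T)" by (rule assoc_mult_mat[OF DV M T])
  also have "\<dots> = D' * (V * (M * T))"
    by (rule assoc_mult_mat[OF D(2) inv(1) mult_carrier_mat[OF M T]])
  also have "\<dots> = mat l l (\<lambda>(x, y). 1 / ?d x * (V * (M * T)) $$ (x, y))"
    unfolding D'_def by (rule mat_diag_mult_left[OF VMT])
  also have "mat_trace \<dots> = (\<Sum>x<l. 1 / ?d x * (V * (M * T)) $$ (x, x))"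
    by (subst mat_trace_eq_sum[of _ l l]) auto
  also have "\<dots> > 0"
  proof (rule sum_pos)
    fix x assume "x \<in> {..<l}"
    then have x: "x < l" by simp
    \<comment> \<open>This column of \<open>T\<close> is also row x of \<open>V\<close>, so the x-th
      diagonal entry of V M V^T is the form v . M v. It is nonzero because U^T maps it to a unit
      vector.\<close>
    define v where "v = col T x"
    have v: "v \<in> carrier_vec l" using T by (intro carrier_vecI) (simp add: v_def)
    have "transpose_mat ?U *\<^sub>v v = col (transpose_mat ?U * T) x"
      unfolding v_def using T x by (intro eq_vecI) auto
    then have "transpose_mat ?U *\<^sub>v v = unit_vec l x" unfolding UT' using x by simp
    moreover have "transpose_mat ?U *\<^sub>v 0\<^sub>v l = 0\<^sub>v l" by (rule mult_mat_zero_vec[OF UT])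
    moreover have "unit_vec l x \<noteq> (0\<^sub>v l :: real vec)" using x by simp
    ultimately have "v \<noteq> 0\<^sub>v l" by metis
    then have "v \<bullet> (M *\<^sub>v v) > 0" by (rule pos_def_matD(2)[OF P v])
    moreover have "(V * (M * T)) $$ (x, x) = v \<bullet> (M *\<^sub>v v)"
    proof -
      have "(V * (M * T)) $$ (x, x) = row V x \<bullet> col (M * T) x" using x inv M T by simp
      also have "row V x = v" unfolding v_def T_def using x inv by simp
      also have "col (M * T) x = M *\<^sub>v v" unfolding v_def using x M T by (intro eq_vecI) auto
      finally show ?thesis .
    qed
    ultimately show "0 < 1 / ?d x * (V * (M * T)) $$ (x, x)" using d[of x] by simp
  qed (use l in auto)
  finally show ?thesis .
qed

section \<open>Positive definiteness of the posterior second moment\<close>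

lemma hcat_carrier:
  "hcat n As \<in> carrier_mat n (sum_list (map dim_col As))"
proof -
  have "length (concat (map cols As)) = sum_list (map dim_col As)"
    by (simp add: length_concat comp_def)
  then show ?thesis unfolding hcat_def by (metis mat_of_cols_carrier(1))
qed

text \<open>\<open>hcat N\<close> fixes the number of rows, so only columns are counted: each block
  contributes \<open>l\<close> of them.\<close>

lemma W_full_carrier: "W_full w N l i j ks \<eta> \<in> carrier_mat N (length (j # ks) * l)"
proof -
  have "dim_col (W_tilde w N l i j \<eta>) = l"
    by (simp add: W_tilde_def W_arrow_mat_def toeplitz_def)
  moreover have "map (dim_col \<circ> W_mat w N l) ks = map (\<lambda>_. l) ks"
    by (simp add: W_mat_def toeplitz_def)
  ultimately show ?thesis
    using hcat_carrier[of N "W_tilde w N l i j \<eta> # map (W_mat w N l) ks"]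
    by (simp only: W_full_def list.map sum_list.Cons map_map sum_list_triv of_nat_id) simp
qed

lemma pos_def_K_full:
  assumes "admissible N (set (j # ks)) \<eta>"
  shows "pos_def_mat (length (j # ks) * l) (K_full l j ks \<eta>)"
proof -
  let ?As = "map (\<lambda>k. par_lam \<eta> k \<cdot>\<^sub>m K_mat l (par_beta \<eta> k)) (j # ks)"
  have "pos_def_mat (length ?As * l) (diag_block_mat ?As)"
  proof (rule pos_def_diag_block_mat)
    fix A assume "A \<in> set ?As"
    then obtain k where "k \<in> set (j # ks)" "A = par_lam \<eta> k \<cdot>\<^sub>m K_mat l (par_beta \<eta> k)"
      by (metis (no_types, lifting) imageE list.set_map)
    then show "pos_def_mat l A" using assms
      by (auto simp: admissible_def intro!: pos_def_mat_smult pos_def_K_mat)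
  qed
  then show ?thesis unfolding K_full_def by simp
qed

text \<open>The posterior precision is the positive definite inverse prior covariance plus a scaled
  Gram matrix, whose form is the squared norm of W v divided by the noise variance. Inverting the
  sum preserves positivity.\<close>

lemma pos_def_post_cov:
  assumes "admissible N (set (j # ks)) \<eta>"
  shows "pos_def_mat (length (j # ks) * l) (post_cov w N l i j ks \<eta>)"
proof -
  define n where "n = length (j # ks) * l"
  define W where "W = W_full w N l i j ks \<eta>"
  define G where "G = (1 / par_var \<eta>) \<cdot>\<^sub>m (transpose_mat W * W)"
  have W: "W \<in> carrier_mat N n" unfolding W_def n_def by (rule W_full_carrier)
  have G: "G \<in> carrier_mat n n" using W by (simp add: G_def)
  have KI: "pos_def_mat n (mat_inv (K_full l j ks \<eta>))"
    unfolding n_def by (intro pos_def_mat_inv pos_def_K_full[OF assms])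
  have "v \<bullet> (G *\<^sub>v v) \<ge> 0" if v: "v \<in> carrier_vec n" for v
  proof -
    have WW: "transpose_mat W * W \<in> carrier_mat n n" using W by simp
    have Wv: "W *\<^sub>v v \<in> carrier_vec N" using W v by simp
    have "v \<bullet> (G *\<^sub>v v) = 1 / par_var \<eta> * (v \<bullet> ((transpose_mat W * W) *\<^sub>v v))"
      using smult_mat_mult_vec[OF WW v] WW v by (simp add: G_def)
    also have "(transpose_mat W * W) *\<^sub>v v = transpose_mat W *\<^sub>v (W *\<^sub>v v)"
      by (rule assoc_mult_mat_vec[OF _ W v]) (use W in simp)
    also have "v \<bullet> (transpose_mat W *\<^sub>v (W *\<^sub>v v)) = (W *\<^sub>v v) \<bullet> (W *\<^sub>v v)"
      using transpose_vec_mult_scalar[OF W v Wv] comm_scalar_prod[of v n "transpose_mat W *\<^sub>v (W *\<^sub>v v)"]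
        v W Wv by simp
    finally show ?thesis using assms by (simp add: admissible_def scalar_prod_def sum_nonneg)
  qed
  then have "pos_def_mat n (mat_inv (K_full l j ks \<eta>) + G)"
    by (rule pos_def_mat_add_semidef[OF KI G])
  moreover have "mat_inv (K_full l j ks \<eta>) + G = G + mat_inv (K_full l j ks \<eta>)"
    by (rule comm_add_mat[OF pos_def_matD(1)[OF KI] G])
  ultimately show ?thesis
    using pos_def_mat_inv unfolding post_cov_def Let_def W_def[symmetric] G_def[symmetric]
      n_def[symmetric] by simp
qed

text \<open>This is the posterior second moment of m: the covariance is positive definite, and the
  outer product of the mean adds a square to its form.\<close>

lemma pos_def_M_hat:
  assumes "admissible N (set (j # ks)) \<eta>"
  shows "pos_def_mat (length (j # ks) * l) (M_hat w N l i j ks \<eta>)"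
proof -
  let ?m = "post_mean w N l i j ks \<eta>"
  note P = pos_def_post_cov[OF assms, of l w i]
  have m: "?m \<in> carrier_vec (length (j # ks) * l)"
    using pos_def_matD(1)[OF P] by (intro carrier_vecI) (simp add: post_mean_def)
  show ?thesis unfolding M_hat_def
    by (rule pos_def_mat_add_semidef[OF P])
      (use outer_prod_quadratic_form[OF m] m in auto)
qed

section \<open>Maximization over the scaling\<close>

text \<open>Separates the scaling from the shape: det (\<lambda> K) = \<lambda>^l det K, and the
  inverse of \<lambda> K is that of K divided by \<lambda>, a factor that passes through the
  trace.\<close>

lemma Q_m_eq:
  assumes lam: "lam > 0" and \<beta>: "0 < \<beta>" "\<beta> < 1" and M: "M \<in> carrier_mat l l"
  shows "Q_m l M lam \<beta>
    = - (real l * ln lam) - ln (det (K_mat l \<beta>)) - mat_trace (mat_inv (K_mat l \<beta>) * M) / lam"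
proof -
  have K: "K_mat l \<beta> \<in> carrier_mat l l" by simp
  note inv = mat_inv_left_right[OF K less_imp_neq[OF det_K_mat_pos[OF \<beta>], symmetric]]
  have "mat_inv (lam \<cdot>\<^sub>m K_mat l \<beta>) = (1 / lam) \<cdot>\<^sub>m mat_inv (K_mat l \<beta>)"
  proof (rule mat_inv_unique)
    have "(1 / lam) \<cdot>\<^sub>m mat_inv (K_mat l \<beta>) * (lam \<cdot>\<^sub>m K_mat l \<beta>)
        = (1 / lam) \<cdot>\<^sub>m (lam \<cdot>\<^sub>m (mat_inv (K_mat l \<beta>) * K_mat l \<beta>))"
      using inv(1) K mult_smult_assoc_mat[OF inv(1), of "lam \<cdot>\<^sub>m K_mat l \<beta>" l "1 / lam"]
        mult_smult_distrib[OF inv(1) K, of lam] by simp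
    then show "(1 / lam) \<cdot>\<^sub>m mat_inv (K_mat l \<beta>) * (lam \<cdot>\<^sub>m K_mat l \<beta>) = 1\<^sub>m l"
      unfolding inv(3) using lam by (intro eq_matI) auto
  qed (use inv in auto)
  then have "mat_inv (lam \<cdot>\<^sub>m K_mat l \<beta>) * M = (1 / lam) \<cdot>\<^sub>m (mat_inv (K_mat l \<beta>) * M)"
    using mult_smult_assoc_mat[OF inv(1) M] by simp
  moreover have C: "mat_inv (K_mat l \<beta>) * M \<in> carrier_mat l l" using inv(1) M by simp
  have "mat_trace ((1 / lam) \<cdot>\<^sub>m (mat_inv (K_mat l \<beta>) * M))
      = mat_trace (mat_inv (K_mat l \<beta>) * M) / lam"
    using carrier_matD[OF C]
    by (simp add: mat_trace_eq_sum[OF C] mat_trace_eq_sum[OF smult_carrier_mat[OF C]]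
        sum_divide_distrib del: index_mult_mat)
  moreover have "ln (det (lam \<cdot>\<^sub>m K_mat l \<beta>)) = real l * ln lam + ln (det (K_mat l \<beta>))"
    using lam det_K_mat_pos[OF \<beta>, of l] carrier_matD[OF K] by (simp add: ln_mult ln_realpow)
  ultimately show ?thesis by (simp add: Q_m_def)
qed

text \<open>This is ln x \<le> x - 1 at x = T / (c \<lambda>), multiplied by c. Equality holds at x
  = 1, that is at \<lambda> = T / c, which explains the update of the scaling.\<close>

lemma profile_log_bound:
  assumes "lam > 0" "T > 0" "c > 0"
  shows "- (c * ln lam) - T / lam \<le> c * ln c - c - c * ln (T :: real)"
proof -
  have "ln (T / (c * lam)) \<le> T / (c * lam) - 1" using assms by (intro ln_le_minus_one) simp
  then have "c * ln (T / (c * lam)) \<le> c * (T / (c * lam) - 1)" using assms by simp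
  also have "\<dots> = T / lam - c" using assms by (simp add: right_diff_distrib)
  finally have "c * (ln T - (ln c + ln lam)) \<le> T / lam - c"
    using assms by (simp add: ln_div ln_mult)
  then show ?thesis by (simp add: algebra_simps)
qed

theorem theorem1:
  fixes w :: "nat \<Rightarrow> nat \<Rightarrow> real" and N l i j k q :: nat
    and \<N> :: "nat set" and ks :: "nat list" and \<eta> :: hyperparams
    and M_k :: "real mat" and \<beta>_hat lam_hat :: real
  assumes "N > 0" and "l > 0"
    and "finite \<N>" and "j \<notin> \<N>" and "i \<in> \<N>"
    and "distinct ks" and "set ks = \<N> - {i}"
    and "admissible N ((\<N> \<union> {j}) - {i}) \<eta>"
    and "k \<in> (\<N> \<union> {j}) - {i}"
    and "q < length (j # ks)" and "(j # ks) ! q = k"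
    and "M_k = diag_block l q (M_hat w N l i j ks \<eta>)"
    and "is_arg_min (Q_beta l M_k) (\<lambda>\<beta>. \<beta> \<in> {0<..<1}) \<beta>_hat"
    and "lam_hat = 1 / real l * mat_trace (mat_inv (K_mat l \<beta>_hat) * M_k)"
  shows "is_arg_max (\<lambda>(lam, \<beta>). Q_m l M_k lam \<beta>)
           (\<lambda>(lam, \<beta>). lam > 0 \<and> \<beta> \<in> {0<..<1}) (lam_hat, \<beta>_hat)"
proof -
  define T where "T \<beta> = mat_trace (mat_inv (K_mat l \<beta>) * M_k)" for \<beta>
  \<comment> \<open>From i in and j outside the input set it follows that i and j differ, so
    removing i keeps j.\<close>
  have "set (j # ks) = (\<N> \<union> {j}) - {i}" using assms(4,5,7) by auto
  then have adm: "admissible N (set (j # ks)) \<eta>" using assms(8) by simp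
  have "Suc q * l \<le> length (j # ks) * l" using assms(10) by (intro mult_le_mono1) simp
  then have "q * l + l \<le> length (j # ks) * l" by simp
  then have P: "pos_def_mat l M_k"
    unfolding assms(12) by (rule pos_def_diag_block[OF pos_def_M_hat[OF adm]])
  note M = pos_def_matD(1)[OF P]
  have Tpos: "T \<beta> > 0" if "0 < \<beta>" "\<beta> < 1" for \<beta>
    unfolding T_def by (rule trace_inv_K_mat_pos[OF that assms(2) P])
  have Qb: "Q_beta l M_k \<beta> = ln (det (K_mat l \<beta>)) + real l * ln (T \<beta>)" for \<beta>
    by (simp add: Q_beta_def T_def)
  \<comment> \<open>\<open>is_arg_min\<close> only says that no feasible value is strictly smaller;
    linearity of the order turns this into \<le>.\<close>
  have hat: "0 < \<beta>_hat" "\<beta>_hat < 1"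
    and min: "\<And>\<beta>. 0 < \<beta> \<Longrightarrow> \<beta> < 1 \<Longrightarrow> Q_beta l M_k \<beta>_hat \<le> Q_beta l M_k \<beta>"
    using assms(13) unfolding is_arg_min_def by (simp_all, meson not_le)
  have lh: "lam_hat = T \<beta>_hat / real l" using assms(14) by (simp add: T_def)
  have lhpos: "lam_hat > 0" unfolding lh using Tpos[OF hat] assms(2) by simp
  \<comment> \<open>The constant left over when the scaling is maximized out: the best value at
    fixed \<beta> is \<open>c - Q_beta l M_k \<beta>\<close>.\<close>
  define c where "c = real l * ln (real l) - real l"
  have bound: "Q_m l M_k lam \<beta> \<le> c - Q_beta l M_k \<beta>" if "lam > 0" "0 < \<beta>" "\<beta> < 1" for lam \<beta>
    using profile_log_bound[OF that(1) Tpos[OF that(2,3)], of "real l"] assms(2)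
    unfolding Q_m_eq[OF that M] Qb c_def T_def[symmetric] by simp
  \<comment> \<open>The bound is attained here, since T / \<lambda> equals l at the chosen
    scaling.\<close>
  have "Q_m l M_k lam_hat \<beta>_hat = c - Q_beta l M_k \<beta>_hat"
    unfolding Q_m_eq[OF lhpos hat M] Qb c_def T_def[symmetric] unfolding lh
    using Tpos[OF hat] assms(2) by (simp add: ln_div right_diff_distrib)
  \<comment> \<open>Any feasible value is at most c minus \<open>Q_beta\<close> at its own \<beta>,
    hence at most c minus the minimum of \<open>Q_beta\<close>, which is the value attained at the
    chosen pair.\<close>
  then have max: "Q_m l M_k lam \<beta> \<le> Q_m l M_k lam_hat \<beta>_hat" if "lam > 0" "0 < \<beta>" "\<beta> < 1" for lam \<beta>
    using bound[OF that] min[OF that(2,3)] by simp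
  then show ?thesis using lhpos hat unfolding is_arg_max_def by (force dest: max)
qed

end
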